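(* The wreath product $\mathbf{Z}\wr\mathbf{Z}$, viewed as a metric space with a word metric associated to a finite generating set, has sparsification number $a(\mathbf{Z}\wr\mathbf{Z})=1$, and $\mathbf{Z}\wr\mathbf{Z}$ has the operator norm localization property.
   Context: $\mathbf{Z}\wr\mathbf{Z}=\left(\bigoplus_{\mathbf{Z}}\mathbf{Z}\right)\rtimes\mathbf{Z}$, with $\mathbf{Z}$ acting by shift; it is finitely generated. Metric Sparsification Property: a metric space $X$ has MS($c$), $0<c\le 1$, if there is a non-decreasing function $f:\mathbf{N}\to\mathbf{N}$ such that for all $m\in\mathbf{N}$ and every finite positive Borel measure $\mu$ on $X$ there is a Borel subset $\Omega=\bigsqcup_{i\in I}\Omega_i$ of $X$ with (i) $d(\Omega_i,\Omega_j)\ge m$ for all $i\ne j$; (ii) $\mathrm{Diam}(\Omega_i)\le f(m)$ for all $i$; (iii) $\mu(\Omega)\ge c\,\mu(X)$. The sparsification number $a(X)$ is the supremum of all $c$ such that $X$ has MS($c$) (and $0$ if there is none). Operator norm localization: let $H$ be a separable infinite-dimensional Hilbert space. A Borel measure on a metric space is locally finite if bounded Borel sets have finite measure; positive measures here are understood to be nonzero. For a positive locally finite Borel measure $\nu$ on $X$, a bounded operator $T$ on $L^2(X,\nu)\otimes H$ has propagation at most $r$ if $\langle T\varphi,\psi\rangle=0$ whenever $d(\mathrm{Supp}(\varphi),\mathrm{Supp}(\psi))>r$; $\mathcal{A}_r(X,\nu)$ is the set of such operators. $X$ has the operator norm localization property with constant $c$ ($0<c\le1$) if there is a non-decreasing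 $f:\mathbf{N}\to\mathbf{N}$ such that for every positive locally finite Borel measure $\nu$ on $X$, every $k\in\mathbf{N}$ and every $T\in\mathcal{A}_k(X,\nu)$ there is a nonzero $\varphi\in L^2(X,\nu)\otimes H$ with $\mathrm{Diam}(\mathrm{Supp}(\varphi))\le f(k)$ and $\|T\varphi\|\ge c\|T\|\|\varphi\|$. $X$ has the operator norm localization property if it has it with some constant $c\in(0,1]$. *)

theory Defs
  imports "HOL-Analysis.Analysis" "HOL-Algebra.Product_Groups" "HOL-Algebra.Generated_Groups"
begin

section \<open>Word metrics\<close>

definition word_length :: "('a, 'b) monoid_scheme \<Rightarrow> 'a set \<Rightarrow> 'a \<Rightarrow> nat" where
  "word_length G S g = (LEAST n. \<exists>ws. length ws = n \<and> set ws \<subseteq> S \<union> m_inv G ` S \<and>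
     foldr (mult G) ws (one G) = g)"

text \<open>The value 0 outside the carrier makes the distance symmetric on the whole type, as
  the locale \<^locale>\<open>Metric_space\<close> demands.\<close>

definition word_dist :: "('a, 'b) monoid_scheme \<Rightarrow> 'a set \<Rightarrow> 'a \<Rightarrow> 'a \<Rightarrow> real" where
  "word_dist G S x y =
     (if x \<in> carrier G \<and> y \<in> carrier G then real (word_length G S (inv\<^bsub>G\<^esub> x \<otimes>\<^bsub>G\<^esub> y)) else 0)"

context group
begin

lemma foldr_mult_closed:
  "set ws \<subseteq> carrier G \<Longrightarrow> foldr (mult G) ws \<one> \<in> carrier G"
  by (induction ws) auto

lemma foldr_mult_append:
  "\<lbrakk>set us \<subseteq> carrier G; set ws \<subseteq> carrier G\<rbrakk>
    \<Longrightarrow> foldr (mult G) (us @ ws) \<one> = foldr (mult G) us \<one> \<otimes> foldr (mult G) ws \<one>"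
  by (induction us) (auto simp: foldr_mult_closed m_assoc simp del: foldr_append)

lemma foldr_mult_inv:
  "set ws \<subseteq> carrier G
    \<Longrightarrow> foldr (mult G) (rev (map (m_inv G) ws)) \<one> = inv (foldr (mult G) ws \<one>)"
proof (induction ws)
  case (Cons w ws)
  then have "foldr (mult G) (rev (map (m_inv G) ws) @ [inv w]) \<one>
      = foldr (mult G) (rev (map (m_inv G) ws)) \<one> \<otimes> foldr (mult G) [inv w] \<one>"
    by (intro foldr_mult_append) auto
  with Cons show ?case
    by (simp add: foldr_mult_closed inv_mult_group del: foldr_append)
qed simp

lemma word_exists:
  assumes "S \<subseteq> carrier G" "g \<in> generate G S"
  shows "\<exists>ws. set ws \<subseteq> S \<union> m_inv G ` S \<and> foldr (mult G) ws \<one> = g"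
  using assms(2)
proof induction
  case one
  show ?case by (rule exI[of _ "[]"]) simp
next
  case (incl h)
  with assms(1) show ?case by (intro exI[of _ "[h]"]) auto
next
  case (inv h)
  with assms(1) show ?case by (intro exI[of _ "[inv h]"]) auto
next
  case (eng h1 h2)
  then obtain us ws where
    "set us \<subseteq> S \<union> m_inv G ` S" "foldr (mult G) us \<one> = h1"
    "set ws \<subseteq> S \<union> m_inv G ` S" "foldr (mult G) ws \<one> = h2" by blast
  moreover have "S \<union> m_inv G ` S \<subseteq> carrier G" using assms(1) by auto
  ultimately show ?case
    using foldr_mult_append[of us ws] by (intro exI[of _ "us @ ws"]) auto
qed

lemma word_length_le:
  "set ws \<subseteq> S \<union> m_inv G ` S \<Longrightarrow> word_length G S (foldr (mult G) ws \<one>) \<le> length ws"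
  unfolding word_length_def by (rule Least_le) blast

lemma word_length_witness:
  assumes "S \<subseteq> carrier G" "generate G S = carrier G" "g \<in> carrier G"
  obtains ws where "length ws = word_length G S g" "set ws \<subseteq> S \<union> m_inv G ` S"
    "foldr (mult G) ws \<one> = g"
proof -
  have "\<exists>n ws. length ws = n \<and> set ws \<subseteq> S \<union> m_inv G ` S \<and> foldr (mult G) ws \<one> = g"
    using word_exists[of S g] assms by auto
  from LeastI_ex[OF this] show ?thesis
    using that unfolding word_length_def by blast
qed

lemma word_length_mult_le:
  assumes "S \<subseteq> carrier G" "generate G S = carrier G" "g \<in> carrier G" "h \<in> carrier G"
  shows "word_length G S (g \<otimes> h) \<le> word_length G S g + word_length G S h"
proof -
  obtain us where us: "length us = word_length G S g" "set us \<subseteq> S \<union> m_inv G ` S"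
    "foldr (mult G) us \<one> = g" using word_length_witness assms by metis
  obtain ws where ws: "length ws = word_length G S h" "set ws \<subseteq> S \<union> m_inv G ` S"
    "foldr (mult G) ws \<one> = h" using word_length_witness assms by metis
  have "S \<union> m_inv G ` S \<subseteq> carrier G" using assms(1) by auto
  then have "foldr (mult G) (us @ ws) \<one> = g \<otimes> h"
    using foldr_mult_append[of us ws] us ws by auto
  with word_length_le[of "us @ ws" S] us ws show ?thesis by auto
qed

lemma word_length_inv_le:
  assumes "S \<subseteq> carrier G" "generate G S = carrier G" "g \<in> carrier G"
  shows "word_length G S (inv g) \<le> word_length G S g"
proof -
  obtain ws where ws: "length ws = word_length G S g" "set ws \<subseteq> S \<union> m_inv G ` S"
    "foldr (mult G) ws \<one> = g" using word_length_witness assms by metis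
  have "set ws \<subseteq> carrier G" using ws(2) assms(1) by auto
  then have "foldr (mult G) (rev (map (m_inv G) ws)) \<one> = inv g"
    using foldr_mult_inv ws by simp
  moreover have "set (rev (map (m_inv G) ws)) \<subseteq> S \<union> m_inv G ` S"
  proof
    fix x assume "x \<in> set (rev (map (m_inv G) ws))"
    then obtain w where "w \<in> S \<union> m_inv G ` S" "x = inv w" using ws(2) by fastforce
    then show "x \<in> S \<union> m_inv G ` S" using assms(1) by auto
  qed
  ultimately show ?thesis
    using word_length_le[of "rev (map (m_inv G) ws)" S] ws(1) by simp
qed

lemma word_length_eq_0:
  assumes "S \<subseteq> carrier G" "generate G S = carrier G" "g \<in> carrier G"
  shows "word_length G S g = 0 \<longleftrightarrow> g = \<one>"
  using word_length_witness[OF assms] word_length_le[of "[]" S] by fastforce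

lemma Metric_space_word_dist:
  assumes "S \<subseteq> carrier G" "generate G S = carrier G"
  shows "Metric_space (carrier G) (word_dist G S)"
proof
  fix x y
  show "0 \<le> word_dist G S x y" by (simp add: word_dist_def)
  have *: "word_length G S (inv x \<otimes> y) \<le> word_length G S (inv y \<otimes> x)"
    if "x \<in> carrier G" "y \<in> carrier G" for x y
    using word_length_inv_le[OF assms, of "inv y \<otimes> x"] that by (simp add: inv_mult_group)
  then show "word_dist G S x y = word_dist G S y x"
    by (auto simp: word_dist_def intro: antisym)
next
  fix x y assume "x \<in> carrier G" "y \<in> carrier G"
  then show "word_dist G S x y = 0 \<longleftrightarrow> x = y"
    using word_length_eq_0[OF assms, of "inv x \<otimes> y"]
    by (simp add: word_dist_def) (metis inv_closed inv_inv inv_equality l_inv)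
next
  fix x y z assume *: "x \<in> carrier G" "y \<in> carrier G" "z \<in> carrier G"
  have "inv x \<otimes> z = (inv x \<otimes> y) \<otimes> (inv y \<otimes> z)"
    using * by (simp add: m_assoc[symmetric]) (simp add: m_assoc)
  then show "word_dist G S x z \<le> word_dist G S x y + word_dist G S y z"
    using word_length_mult_le[OF assms, of "inv x \<otimes> y" "inv y \<otimes> z"] *
    by (simp add: word_dist_def)
qed

end


section \<open>The wreath product of the integers with themselves\<close>

definition semidirect_product ::
  "('a, 'c) monoid_scheme \<Rightarrow> ('b, 'd) monoid_scheme \<Rightarrow> ('b \<Rightarrow> 'a \<Rightarrow> 'a) \<Rightarrow> ('a \<times> 'b) monoid" where
  "semidirect_product N H \<alpha> =
     \<lparr>carrier = carrier N \<times> carrier H,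
      monoid.mult = (\<lambda>(a, x) (b, y). (a \<otimes>\<^bsub>N\<^esub> \<alpha> x b, x \<otimes>\<^bsub>H\<^esub> y)),
      one = (\<one>\<^bsub>N\<^esub>, \<one>\<^bsub>H\<^esub>)\<rparr>"

definition shift :: "int \<Rightarrow> (int \<Rightarrow> int) \<Rightarrow> int \<Rightarrow> int" where
  "shift n f = (\<lambda>i. f (i - n))"

definition wreath_Z_Z :: "((int \<Rightarrow> int) \<times> int) monoid" where
  "wreath_Z_Z = semidirect_product (sum_group UNIV (\<lambda>_. integer_group)) integer_group shift"

lemma carrier_wreath_Z_Z: "carrier wreath_Z_Z = {f. finite {i. f i \<noteq> 0}} \<times> UNIV"
  by (simp add: wreath_Z_Z_def semidirect_product_def carrier_sum_group)

lemma mult_wreath_Z_Z: "(f, m) \<otimes>\<^bsub>wreath_Z_Z\<^esub> (g, n) = (\<lambda>i. f i + g (i - m), m + n)"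
  by (simp add: wreath_Z_Z_def semidirect_product_def shift_def restrict_def)

lemma one_wreath_Z_Z: "\<one>\<^bsub>wreath_Z_Z\<^esub> = (\<lambda>i. 0, 0)"
  by (simp add: wreath_Z_Z_def semidirect_product_def restrict_def)

lemma finite_support_shift:
  fixes f :: "int \<Rightarrow> int"
  assumes "finite {i. f i \<noteq> 0}"
  shows "finite {i. f (i - m) \<noteq> 0}"
proof -
  have "{i. f (i - m) \<noteq> 0} = (\<lambda>i. i + m) ` {i. f i \<noteq> 0}"
    by (force simp: image_iff intro: exI[of _ "_ - m"])
  with assms show ?thesis by simp
qed

lemma finite_support_add:
  fixes f g :: "int \<Rightarrow> int"
  assumes "finite {i. f i \<noteq> 0}" "finite {i. g i \<noteq> 0}"
  shows "finite {i. f i + g i \<noteq> 0}"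
  by (rule finite_subset[OF _ finite_UnI[OF assms]]) auto

lemma group_wreath_Z_Z: "group wreath_Z_Z"
proof (rule groupI)
  fix x assume x: "x \<in> carrier wreath_Z_Z"
  obtain f m where [simp]: "x = (f, m)" by force
  have "finite {i. - f (i - (- m)) \<noteq> 0}"
    using x finite_support_shift[of f "- m"] by (simp add: carrier_wreath_Z_Z)
  then show "\<exists>y\<in>carrier wreath_Z_Z. y \<otimes>\<^bsub>wreath_Z_Z\<^esub> x = \<one>\<^bsub>wreath_Z_Z\<^esub>"
    by (intro bexI[of _ "(\<lambda>i. - f (i - (- m)), - m)"])
       (auto simp: carrier_wreath_Z_Z mult_wreath_Z_Z one_wreath_Z_Z)
qed (auto simp: carrier_wreath_Z_Z mult_wreath_Z_Z one_wreath_Z_Z algebra_simps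
      intro!: finite_support_add finite_support_shift)

lemma finitely_generated_wreath_Z_Z:
  "\<exists>S. finite S \<and> S \<subseteq> carrier wreath_Z_Z \<and> generate wreath_Z_Z S = carrier wreath_Z_Z"
proof -
  define e :: "int \<Rightarrow> int \<Rightarrow> int \<Rightarrow> int" where "e = (\<lambda>j c i. if i = j then c else 0)"
  define S :: "((int \<Rightarrow> int) \<times> int) set" where "S = {(e 0 1, 0), (\<lambda>i. 0, 1)}"
  let ?K = "generate wreath_Z_Z S"
  interpret group wreath_Z_Z by (rule group_wreath_Z_Z)
  have S: "S \<subseteq> carrier wreath_Z_Z"
    by (auto simp: S_def e_def carrier_wreath_Z_Z)
  interpret K: subgroup ?K wreath_Z_Z by (rule generate_is_subgroup[OF S])
  have inv_eq: "inv\<^bsub>wreath_Z_Z\<^esub> (f, m) = (\<lambda>i. - f (i + m), - m)"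
    if "finite {i. f i \<noteq> 0}" for f m
    using that finite_support_shift[of f "- m"]
    by (intro inv_equality) (auto simp: carrier_wreath_Z_Z mult_wreath_Z_Z one_wreath_Z_Z)
  have mult: "(\<lambda>i. f i + g (i - m), m + n) \<in> ?K" if "(f, m) \<in> ?K" "(g, n) \<in> ?K" for f g m n
    using K.m_closed[OF that] by (simp add: mult_wreath_Z_Z)
  have inv: "(\<lambda>i. - f (i + m), - m) \<in> ?K" if "(f, m) \<in> ?K" for f m
  proof -
    have "finite {i. f i \<noteq> 0}" using that K.subset by (auto simp: carrier_wreath_Z_Z)
    with K.m_inv_closed[OF that] show ?thesis by (simp add: inv_eq)
  qed
  have one: "(\<lambda>i. 0, 0) \<in> ?K" using K.one_closed by (simp add: one_wreath_Z_Z)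
  have t: "(\<lambda>i. 0, 1) \<in> ?K" and a: "(e 0 1, 0) \<in> ?K"
    by (auto simp: S_def intro: generate.incl)
  have tn: "(\<lambda>i. 0, n) \<in> ?K" for n
  proof (induction n rule: int_induct[of _ 0])
    case (step1 n)
    with mult[OF _ t] show ?case by simp
  next
    case (step2 n)
    with mult[OF _ inv[OF t]] show ?case by simp
  qed (rule one)
  have ac: "(e 0 c, 0) \<in> ?K" for c
  proof (induction c rule: int_induct[of _ 0])
    case base
    show ?case using one by (simp add: e_def)
  next
    case (step1 c)
    have "(\<lambda>i. e 0 c i + e 0 1 i) = e 0 (c + 1)" by (auto simp: e_def)
    with mult[OF step1(2) a] show ?case by simp
  next
    case (step2 c)
    have "(\<lambda>i. e 0 c i + - e 0 1 i) = e 0 (c - 1)" by (auto simp: e_def)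
    with mult[OF step2(2) inv[OF a]] show ?case by simp
  qed
  have ajc: "(e j c, 0) \<in> ?K" for j c
  proof -
    have "(\<lambda>i. e 0 c (i - j)) = e j c" by (auto simp: e_def)
    with mult[OF mult[OF tn[of j] ac[of c]] tn[of "- j"]] show ?thesis by simp
  qed
  have base: "(f, 0) \<in> ?K" if "finite A" "{i. f i \<noteq> 0} \<subseteq> A" for A f
    using that
  proof (induction A arbitrary: f)
    case empty
    then have "f = (\<lambda>i. 0)" by auto
    with one show ?case by simp
  next
    case (insert j A)
    have "(f(j := 0), 0) \<in> ?K" by (rule insert.IH) (use insert.prems in auto)
    moreover have "(\<lambda>i. (f(j := 0)) i + e j (f j) i) = f" by (auto simp: e_def)
    ultimately show ?case using mult[OF _ ajc[of j "f j"]] by fastforce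
  qed
  have "(f, n) \<in> ?K" if "finite {i. f i \<noteq> 0}" for f n
    using mult[OF base[OF that subset_refl] tn[of n]] by simp
  then have "carrier wreath_Z_Z \<subseteq> ?K" by (auto simp: carrier_wreath_Z_Z)
  with S K.subset show ?thesis by (intro exI[of _ S]) (auto simp: S_def)
qed


section \<open>Metric sparsification\<close>

context Metric_space
begin

definition mdiam :: "'a set \<Rightarrow> ennreal" where
  "mdiam A = (SUP x\<in>A. SUP y\<in>A. ennreal (d x y))"

definition msetdist :: "'a set \<Rightarrow> 'a set \<Rightarrow> ennreal" where
  "msetdist A B = (INF x\<in>A. INF y\<in>B. ennreal (d x y))"

definition borel_measure_on :: "'a measure \<Rightarrow> bool" where
  "borel_measure_on \<mu> \<longleftrightarrow> space \<mu> = M \<and> sets \<mu> = sigma_sets M {U. openin mtopology U}"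

text \<open>The pieces of \<open>\<Omega>\<close> form a disjoint family of sets; only their union has to be Borel.\<close>

definition metric_sparsification :: "real \<Rightarrow> bool" where
  "metric_sparsification c \<longleftrightarrow> 0 < c \<and> c \<le> 1 \<and>
     (\<exists>f :: nat \<Rightarrow> nat. mono f \<and>
       (\<forall>(m :: nat) \<mu>. borel_measure_on \<mu> \<and> finite_measure \<mu> \<longrightarrow>
         (\<exists>\<W>. disjoint \<W> \<and> \<Union>\<W> \<in> sets \<mu> \<and>
           (\<forall>A\<in>\<W>. \<forall>B\<in>\<W>. A \<noteq> B \<longrightarrow> msetdist A B \<ge> of_nat m) \<and>
           (\<forall>A\<in>\<W>. mdiam A \<le> of_nat (f m)) \<and>
           measure \<mu> (\<Union>\<W>) \<ge> c * measure \<mu> M)))"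

definition sparsification_number :: real where
  "sparsification_number =
     (if \<exists>c. metric_sparsification c then Sup {c. metric_sparsification c} else 0)"

end


section \<open>Complex Hilbert spaces\<close>

class complex_hilbert_space = banach +
  fixes scaleC :: "complex \<Rightarrow> 'a \<Rightarrow> 'a"
    and cinner :: "'a \<Rightarrow> 'a \<Rightarrow> complex"
  assumes scaleC_add_right: "scaleC a (x + y) = scaleC a x + scaleC a y"
    and scaleC_add_left: "scaleC (a + b) x = scaleC a x + scaleC b x"
    and scaleC_scaleC: "scaleC a (scaleC b x) = scaleC (a * b) x"
    and scaleC_of_real: "scaleC (complex_of_real r) x = scaleR r x"
    and cinner_commute: "cinner x y = cnj (cinner y x)"
    and cinner_add_left: "cinner (x + y) z = cinner x z + cinner y z"
    and cinner_scaleC_left: "cinner (scaleC a x) y = a * cinner x y"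
    and cinner_self: "cinner x x = complex_of_real ((norm x)\<^sup>2)"

instantiation complex :: complex_hilbert_space
begin

definition scaleC_complex :: "complex \<Rightarrow> complex \<Rightarrow> complex" where
  "scaleC_complex a x = a * x"

definition cinner_complex :: "complex \<Rightarrow> complex \<Rightarrow> complex" where
  "cinner_complex x y = x * cnj y"

instance
  by standard
    (auto simp: scaleC_complex_def cinner_complex_def algebra_simps scaleR_conv_of_real
      complex_norm_square[symmetric])

end

lemma vector_space_scaleC:
  "vector_space (scaleC :: complex \<Rightarrow> 'h \<Rightarrow> 'h::complex_hilbert_space)"
  using scaleC_of_real[of 1]
  by unfold_locales (auto simp: scaleC_add_right scaleC_add_left scaleC_scaleC)

definition infinite_dimensional :: "'h::complex_hilbert_space itself \<Rightarrow> bool" where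
  "infinite_dimensional _ \<longleftrightarrow>
     \<not> (\<exists>B :: 'h set. finite B \<and> module.span scaleC B = UNIV)"


section \<open>Square-integrable functions with values in a separable Hilbert space\<close>

text \<open>For separable \<open>H\<close> the Hilbert space tensor product of \<open>L\<^sup>2(X, \<nu>)\<close> with \<open>H\<close> is the space
  \<open>L\<^sup>2(X, \<nu>; H)\<close>.  Its elements are represented by functions, equality being equality almost
  everywhere; a bounded operator is represented by a map on representatives that respects
  this equality and is linear and bounded up to it.\<close>

definition L2_fun ::
  "'a measure \<Rightarrow> ('a \<Rightarrow> 'h::{complex_hilbert_space, second_countable_topology}) set" where
  "L2_fun \<nu> = {\<phi> \<in> borel_measurable \<nu>. integrable \<nu> (\<lambda>x. (norm (\<phi> x))\<^sup>2)}"

definition L2_norm ::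
  "'a measure \<Rightarrow> ('a \<Rightarrow> 'h::{complex_hilbert_space, second_countable_topology}) \<Rightarrow> real" where
  "L2_norm \<nu> \<phi> = sqrt (\<integral>x. (norm (\<phi> x))\<^sup>2 \<partial>\<nu>)"

definition L2_inner ::
  "'a measure \<Rightarrow> ('a \<Rightarrow> 'h::{complex_hilbert_space, second_countable_topology})
    \<Rightarrow> ('a \<Rightarrow> 'h) \<Rightarrow> complex" where
  "L2_inner \<nu> \<phi> \<psi> = (\<integral>x. cinner (\<phi> x) (\<psi> x) \<partial>\<nu>)"

definition L2_operator ::
  "'a measure \<Rightarrow> (('a \<Rightarrow> 'h::{complex_hilbert_space, second_countable_topology}) \<Rightarrow> ('a \<Rightarrow> 'h))
    \<Rightarrow> bool" where
  "L2_operator \<nu> T \<longleftrightarrow>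
     (\<forall>\<phi>\<in>L2_fun \<nu>. T \<phi> \<in> L2_fun \<nu>) \<and>
     (\<forall>\<phi>\<in>L2_fun \<nu>. \<forall>\<psi>\<in>L2_fun \<nu>. (AE x in \<nu>. \<phi> x = \<psi> x) \<longrightarrow> (AE x in \<nu>. T \<phi> x = T \<psi> x)) \<and>
     (\<forall>\<phi>\<in>L2_fun \<nu>. \<forall>\<psi>\<in>L2_fun \<nu>. AE x in \<nu>. T (\<lambda>y. \<phi> y + \<psi> y) x = T \<phi> x + T \<psi> x) \<and>
     (\<forall>a. \<forall>\<phi>\<in>L2_fun \<nu>. AE x in \<nu>. T (\<lambda>y. scaleC a (\<phi> y)) x = scaleC a (T \<phi> x)) \<and>
     (\<exists>B. \<forall>\<phi>\<in>L2_fun \<nu>. L2_norm \<nu> (T \<phi>) \<le> B * L2_norm \<nu> \<phi>)"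

definition L2_onorm ::
  "'a measure \<Rightarrow> (('a \<Rightarrow> 'h::{complex_hilbert_space, second_countable_topology}) \<Rightarrow> ('a \<Rightarrow> 'h))
    \<Rightarrow> real" where
  "L2_onorm \<nu> T = (SUP \<phi>\<in>L2_fun \<nu>. L2_norm \<nu> (T \<phi>) / L2_norm \<nu> \<phi>)"


section \<open>Operator norm localization\<close>

context Metric_space
begin

definition locally_finite_measure :: "'a measure \<Rightarrow> bool" where
  "locally_finite_measure \<nu> \<longleftrightarrow> (\<forall>A\<in>sets \<nu>. mbounded A \<longrightarrow> emeasure \<nu> A < \<infinity>)"

text \<open>The support of an almost-everywhere class: the complement of the union of all open
  sets on which the function vanishes almost everywhere.\<close>

definition L2_support ::
  "'a measure \<Rightarrow> ('a \<Rightarrow> 'h::{complex_hilbert_space, second_countable_topology}) \<Rightarrow> 'a set" where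
  "L2_support \<nu> \<phi> =
     M - \<Union>{U. openin mtopology U \<and> (AE x in \<nu>. x \<in> U \<longrightarrow> \<phi> x = 0)}"

definition propagation_at_most ::
  "'a measure \<Rightarrow> real \<Rightarrow>
    (('a \<Rightarrow> 'h::{complex_hilbert_space, second_countable_topology}) \<Rightarrow> ('a \<Rightarrow> 'h)) \<Rightarrow> bool" where
  "propagation_at_most \<nu> r T \<longleftrightarrow>
     (\<forall>\<phi>\<in>L2_fun \<nu>. \<forall>\<psi>\<in>L2_fun \<nu>.
        msetdist (L2_support \<nu> \<phi>) (L2_support \<nu> \<psi>) > ennreal r \<longrightarrow> L2_inner \<nu> (T \<phi>) \<psi> = 0)"

definition finite_propagation_operators ::
  "real \<Rightarrow> 'a measure \<Rightarrow>
    (('a \<Rightarrow> 'h::{complex_hilbert_space, second_countable_topology}) \<Rightarrow> ('a \<Rightarrow> 'h)) set" where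
  "finite_propagation_operators r \<nu> = {T. L2_operator \<nu> T \<and> propagation_at_most \<nu> r T}"

definition operator_norm_localization_with ::
  "'h::{complex_hilbert_space, second_countable_topology} itself \<Rightarrow> real \<Rightarrow> bool" where
  "operator_norm_localization_with _ c \<longleftrightarrow> 0 < c \<and> c \<le> 1 \<and>
     (\<exists>f :: nat \<Rightarrow> nat. mono f \<and>
       (\<forall>\<nu>. borel_measure_on \<nu> \<and> locally_finite_measure \<nu> \<and> emeasure \<nu> M \<noteq> 0 \<longrightarrow>
         (\<forall>(k :: nat). \<forall>T \<in> (finite_propagation_operators (real k) \<nu> :: (('a \<Rightarrow> 'h) \<Rightarrow> ('a \<Rightarrow> 'h)) set).
           \<exists>\<phi>\<in>L2_fun \<nu>. \<not> (AE x in \<nu>. \<phi> x = 0) \<and>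
             mdiam (L2_support \<nu> \<phi>) \<le> of_nat (f k) \<and>
             L2_norm \<nu> (T \<phi>) \<ge> c * L2_onorm \<nu> T * L2_norm \<nu> \<phi>)))"

definition operator_norm_localization ::
  "'h::{complex_hilbert_space, second_countable_topology} itself \<Rightarrow> bool" where
  "operator_norm_localization H \<longleftrightarrow> (\<exists>c. operator_norm_localization_with H c)"

end

end

theory Submission
  imports Defs
begin

text \<open>
  The group has Folner sets: finite \<open>F\<close> for which the thickening \<open>F B\<close> by a word ball \<open>B\<close> is
  barely larger than \<open>F\<close>.  Since the word metric is left invariant, \<open>g F B\<close> is the thickening of
  \<open>g F\<close>, and summing a weight over all translates \<open>g F\<close> multiplies its total mass by \<open>|F|\<close>.
  Hence for every weight some translate \<open>g F\<close> carries almost all the mass of \<open>g F B\<close>.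

  For sparsification, take such a piece, discard its thickening and repeat on the rest of a large
  ball; the fraction of mass lost is arbitrarily small.  For operator norm localization, let
  \<open>\<phi>\<close> almost attain the norm of \<open>T\<close> and compare the weights \<open>|\<phi>|\<^sup>2\<close> on \<open>g F B\<close> and \<open>|T \<phi>|\<^sup>2\<close> on
  \<open>g F\<close>: on \<open>g F\<close> the function \<open>T \<phi>\<close> depends only on the restriction of \<open>\<phi>\<close> to \<open>g F B\<close>, so for some
  \<open>g\<close> this restriction is stretched almost as much as \<open>\<phi>\<close>.
\<close>

section \<open>Preliminaries: monotone bounds and measures on countable discrete spaces\<close>

no_notation subset_mset (infix \<open><#\<close> 50)

text \<open>Both properties ask for one non-decreasing function, while the arguments below give a
  bound for each \<open>m\<close> separately. The partial sums of these bounds are non-decreasing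
  and dominate every one of them.\<close>

lemma monotone_bound_choice:
  fixes P :: "nat \<Rightarrow> nat \<Rightarrow> bool"
  assumes ex: "\<And>m. \<exists>D. P m D" and up: "\<And>m D D'. P m D \<Longrightarrow> D \<le> D' \<Longrightarrow> P m D'"
  shows "\<exists>f. mono f \<and> (\<forall>m. P m (f m))"
proof -
  obtain D where D: "\<And>m. P m (D m)" using ex by metis
  have "mono (\<lambda>m. \<Sum>j\<le>m. D j)" by (intro monoI sum_mono2) auto
  moreover have "D m \<le> (\<Sum>j\<le>m. D j)" for m by (rule member_le_sum) auto
  ultimately show ?thesis using D up by blast
qed

lemma L2_norm_nonneg: "0 \<le> L2_norm \<nu> \<phi>"
  by (simp add: L2_norm_def)

text \<open>Such a measure is the density of its point masses against counting measure. This turns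
  squared L2 norms into sums over group elements, on which translations act.\<close>

lemma nn_integral_countable_discrete:
  assumes "countable A" "sets \<nu> = Pow A"
  shows "(\<integral>\<^sup>+x. f x \<partial>\<nu>) = (\<integral>\<^sup>+x. emeasure \<nu> {x} * f x \<partial>count_space A)"
proof -
  have "\<nu> = density (count_space A) (\<lambda>x. emeasure \<nu> {x})"
  proof (rule measure_eqI_countable[of _ A])
    fix a assume "a \<in> A"
    then show "emeasure \<nu> {a} = emeasure (density (count_space A) (\<lambda>x. emeasure \<nu> {x})) {a}"
      by (subst emeasure_density) (auto simp: nn_integral_count_space'[of "{a}"] )
  qed (use assms in auto)
  then have "(\<integral>\<^sup>+x. f x \<partial>\<nu>) = (\<integral>\<^sup>+x. f x \<partial>density (count_space A) (\<lambda>x. emeasure \<nu> {x}))"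
    by (rule arg_cong)
  also have "\<dots> = (\<integral>\<^sup>+x. emeasure \<nu> {x} * f x \<partial>count_space A)"
    by (rule nn_integral_density) auto
  finally show ?thesis .
qed

section \<open>Averaging over translates\<close>

context group
begin

text \<open>\<open>B\<close> multiplies from the right because the word metric is left invariant:
  with \<open>B\<close> a ball about the identity, \<open>F <#> B\<close> is the neighbourhood of
  \<open>F\<close>. The strict inequality excludes \<open>F = {}\<close>.\<close>

definition Folner_condition :: bool where
  "Folner_condition \<longleftrightarrow> (\<forall>B \<epsilon>. finite B \<longrightarrow> B \<subseteq> carrier G \<longrightarrow> (0::real) < \<epsilon> \<longrightarrow>
     (\<exists>F. finite F \<and> F \<subseteq> carrier G \<and> real (card (F <#> B)) < (1 + \<epsilon>) * real (card F)))"

lemma l_coset_conv_image: "g <# F = (\<otimes>) g ` F"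
  by (auto simp: l_coset_def)

lemma sum_l_coset:
  assumes "F \<subseteq> carrier G" "g \<in> carrier G"
  shows "sum w (g <# F) = (\<Sum>h\<in>F. w (g \<otimes> h))"
  unfolding l_coset_conv_image
  by (subst sum.reindex) (use assms in \<open>auto intro!: inj_onI simp: subset_iff\<close>)

lemma finite_set_mult: "finite F \<Longrightarrow> finite B \<Longrightarrow> finite (F <#> B)"
  by (auto simp: set_mult_def)

text \<open>Right multiplication by a fixed \<open>h\<close> permutes the group, so each of the
  \<open>card F\<close> summands has the same integral as \<open>w\<close>.\<close>

lemma nn_integral_sum_translates:
  assumes "F \<subseteq> carrier G"
  shows "(\<integral>\<^sup>+g. (\<Sum>h\<in>F. w (g \<otimes> h)) \<partial>count_space (carrier G))
    = of_nat (card F) * (\<integral>\<^sup>+g. w g \<partial>count_space (carrier G))"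
proof -
  have "(\<integral>\<^sup>+g. w (g \<otimes> h) \<partial>count_space (carrier G)) = (\<integral>\<^sup>+g. w g \<partial>count_space (carrier G))"
    if "h \<in> F" for h
  proof (rule nn_integral_bij_count_space)
    show "bij_betw (\<lambda>g. g \<otimes> h) (carrier G) (carrier G)"
      using that assms
      by (intro bij_betw_byWitness[where f' = "\<lambda>g. g \<otimes> inv h"]) (auto simp: m_assoc)
  qed
  then show ?thesis by (subst nn_integral_sum) auto
qed

text \<open>If the sum of \<open>u\<close> over \<open>g <# F\<close> never exceeded that of
  \<open>w\<close> over \<open>g <# F'\<close>, adding up over all \<open>g\<close> would contradict
  \<open>less\<close>, since each group element is counted \<open>card F\<close> and
  \<open>card F'\<close> times.\<close>

lemma exists_translate_sum_less:
  fixes u w :: "'a \<Rightarrow> ennreal"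
  assumes "F \<subseteq> carrier G" "F' \<subseteq> carrier G"
    and less: "of_nat (card F') * (\<integral>\<^sup>+g. w g \<partial>count_space (carrier G))
      < of_nat (card F) * (\<integral>\<^sup>+g. u g \<partial>count_space (carrier G))"
  obtains g where "g \<in> carrier G" "sum w (g <# F') < sum u (g <# F)"
proof (rule ccontr)
  assume *: "\<not> thesis"
  have "(\<integral>\<^sup>+g. (\<Sum>h\<in>F. u (g \<otimes> h)) \<partial>count_space (carrier G))
      \<le> (\<integral>\<^sup>+g. (\<Sum>h\<in>F'. w (g \<otimes> h)) \<partial>count_space (carrier G))"
    using * that assms by (intro nn_integral_mono) (auto simp: sum_l_coset not_less[symmetric])
  with less show False by (simp add: nn_integral_sum_translates assms not_less[symmetric])
qed

end

section \<open>Word balls, translates and the discrete topology of the word metric\<close>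

locale finitely_generated_group = group G for G (structure) +
  fixes S
  assumes finite_gens: "finite S" and gens_carrier: "S \<subseteq> carrier G"
    and generate_gens: "generate G S = carrier G"
begin

sublocale Metric_space "carrier G" "word_dist G S"
  by (rule Metric_space_word_dist[OF gens_carrier generate_gens])

definition word_ball :: "nat \<Rightarrow> 'a set" where
  "word_ball n = {g \<in> carrier G. word_length G S g \<le> n}"

lemma word_ball_carrier: "word_ball n \<subseteq> carrier G"
  by (auto simp: word_ball_def)

lemma one_in_word_ball: "\<one> \<in> word_ball n"
  using word_length_eq_0[OF gens_carrier generate_gens, of \<one>] by (simp add: word_ball_def)

text \<open>Only finitely many words of length at most \<open>n\<close> can be spelled with the
  generators and their inverses.\<close>

lemma finite_word_ball: "finite (word_ball n)"
proof (rule finite_subset)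
  show "word_ball n
      \<subseteq> (\<lambda>ws. foldr (mult G) ws \<one>) ` {ws. set ws \<subseteq> S \<union> m_inv G ` S \<and> length ws \<le> n}"
  proof
    fix g assume g: "g \<in> word_ball n"
    then obtain ws where "length ws = word_length G S g" "set ws \<subseteq> S \<union> m_inv G ` S"
      "foldr (mult G) ws \<one> = g"
      using word_length_witness[OF gens_carrier generate_gens] by (auto simp: word_ball_def)
    with g show "g \<in> (\<lambda>ws. foldr (mult G) ws \<one>) ` {ws. set ws \<subseteq> S \<union> m_inv G ` S \<and> length ws \<le> n}"
      by (auto simp: word_ball_def)
  qed
  show "finite ((\<lambda>ws. foldr (mult G) ws \<one>) ` {ws. set ws \<subseteq> S \<union> m_inv G ` S \<and> length ws \<le> n})"
    by (intro finite_imageI finite_lists_length_le) (use finite_gens in auto)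
qed

lemma UN_word_ball: "(\<Union>n. word_ball n) = carrier G"
  by (auto simp: word_ball_def)

lemma countable_carrier: "countable (carrier G)"
  unfolding UN_word_ball[symmetric]
  by (intro countable_UN) (auto intro: countable_finite finite_word_ball)

lemma word_dist_translate:
  assumes "g \<in> carrier G" "x \<in> carrier G" "y \<in> carrier G"
  shows "word_dist G S (g \<otimes> x) (g \<otimes> y) = word_dist G S x y"
proof -
  have "inv (g \<otimes> x) \<otimes> (g \<otimes> y) = inv x \<otimes> y"
    using assms by (simp add: inv_mult_group m_assoc) (simp add: m_assoc[symmetric])
  with assms show ?thesis by (simp add: word_dist_def)
qed

text \<open>With \<open>x = g h\<close>, a point \<open>y\<close> within distance \<open>n\<close>
  equals \<open>g h (inv x y)\<close> and so lies in the thickening. Word distances are integers, so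
  a point outside it is a full \<open>n + 1\<close> away; this yields the strict inequality that
  propagation asks for.\<close>

lemma word_dist_outside_l_coset:
  assumes "g \<in> carrier G" "F \<subseteq> carrier G" "x \<in> g <# F"
    and "y \<in> carrier G" "y \<notin> g <# (F <#> word_ball n)"
  shows "real n + 1 \<le> word_dist G S x y"
proof (rule ccontr)
  assume *: "\<not> ?thesis"
  obtain h where h: "h \<in> F" "x = g \<otimes> h" using assms by (auto simp: l_coset_def)
  have x: "x \<in> carrier G" "h \<in> carrier G" using h assms by auto
  have "inv x \<otimes> y \<in> word_ball n"
    using * x assms by (auto simp: word_dist_def word_ball_def)
  then have "h \<otimes> (inv x \<otimes> y) \<in> F <#> word_ball n" using h by (auto simp: set_mult_def)
  then have "g \<otimes> (h \<otimes> (inv x \<otimes> y)) \<in> g <# (F <#> word_ball n)" by (auto simp: l_coset_def)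
  moreover have "g \<otimes> (h \<otimes> (inv x \<otimes> y)) = y"
    using x h assms by (simp add: m_assoc[symmetric])
  ultimately show False using assms by simp
qed

lemma l_coset_subset_thickening:
  assumes "F \<subseteq> carrier G"
  shows "g <# F \<subseteq> g <# (F <#> word_ball n)"
proof -
  have "F \<subseteq> F <#> word_ball n"
    using assms one_in_word_ball[of n] by (force simp: set_mult_def)
  then show ?thesis by (auto simp: l_coset_def)
qed

text \<open>Left translation is an isometry, so a bound for the finite set \<open>F\<close> serves
  all its translates, and \<open>D\<close> can be fixed before \<open>g\<close>.\<close>

lemma finite_mdiam_l_coset_bound:
  assumes "finite F" "F \<subseteq> carrier G"
  obtains D :: nat where "\<And>g A. g \<in> carrier G \<Longrightarrow> A \<subseteq> g <# F \<Longrightarrow> mdiam A \<le> of_nat D"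
proof -
  obtain D where D: "\<And>x y. x \<in> F \<Longrightarrow> y \<in> F \<Longrightarrow> word_length G S (inv x \<otimes> y) \<le> D"
  proof -
    have "finite ((\<lambda>(x, y). word_length G S (inv x \<otimes> y)) ` (F \<times> F))" using assms by simp
    then show ?thesis using that by (fastforce simp: finite_nat_set_iff_bounded_le)
  qed
  show ?thesis
  proof
    fix g A assume g: "g \<in> carrier G" "A \<subseteq> g <# F"
    have "ennreal (word_dist G S x y) \<le> of_nat D" if xy: "x \<in> A" "y \<in> A" for x y
    proof -
      obtain a b where ab: "a \<in> F" "b \<in> F" "x = g \<otimes> a" "y = g \<otimes> b"
        using xy g(2) unfolding l_coset_conv_image by blast
      then have "word_dist G S x y = word_dist G S a b"
        using word_dist_translate g assms by blast
      also have "\<dots> \<le> real D" using D ab by (auto simp: word_dist_def)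
      finally show ?thesis by (simp add: ennreal_of_nat_eq_real_of_nat ennreal_leI)
    qed
    then show "mdiam A \<le> of_nat D" unfolding mdiam_def by (intro SUP_least)
  qed
qed

text \<open>Distances are integers, so open balls of radius 1 are singletons and the topology is
  discrete. Consequently every subset is Borel and every function is measurable.\<close>

lemma openin_word_metric: "openin mtopology U \<longleftrightarrow> U \<subseteq> carrier G"
proof
  assume U: "U \<subseteq> carrier G"
  have "mball x 1 \<subseteq> U" if "x \<in> U" for x
  proof
    fix y assume y: "y \<in> mball x 1"
    then have "word_dist G S x y = 0" by (auto simp: word_dist_def split: if_splits)
    then show "y \<in> U" using y that by auto
  qed
  then show "openin mtopology U"
    unfolding openin_mtopology using U by (blast intro: zero_less_one)
qed (simp add: openin_mtopology)

lemma sets_borel_measure_on: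
  assumes "borel_measure_on \<mu>"
  shows "sets \<mu> = Pow (carrier G)"
proof -
  have "sigma_sets (carrier G) (Pow (carrier G)) = Pow (carrier G)"
    by (rule sigma_algebra.sigma_sets_eq[OF sigma_algebra_Pow])
  with assms show ?thesis by (simp add: borel_measure_on_def openin_word_metric Pow_def)
qed


section \<open>Metric sparsification\<close>

text \<open>Averaging with the same weight, extended by zero off \<open>K\<close>, on both sides:
  over all translates the thickened sets collect the mass \<open>card (F <#> B)\<close> times, the
  original ones \<open>card F\<close> times.\<close>

lemma exists_translate_small_boundary:
  assumes F: "finite F" "F \<subseteq> carrier G" "finite B" "B \<subseteq> carrier G"
    and card: "real (card (F <#> B)) < (1 + \<epsilon>) * real (card F)" and "0 < \<epsilon>"
    and w: "\<And>x. x \<in> K \<Longrightarrow> (0::real) \<le> w x" and K: "finite K" "K \<subseteq> carrier G" and pos: "0 < sum w K"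
  obtains g where "g \<in> carrier G"
    "sum w (K \<inter> (g <# (F <#> B))) < (1 + \<epsilon>) * sum w (K \<inter> (g <# F))"
proof -
  define v where "v x = (if x \<in> K then w x else 0)" for x
  have v: "0 \<le> v x" for x using w by (simp add: v_def)
  have sum_v: "sum v A = sum w (K \<inter> A)" if "finite A" for A
    using that by (simp add: v_def sum.inter_restrict[symmetric] Int_commute)
  have int_v: "(\<integral>\<^sup>+x. ennreal (c * v x) \<partial>count_space (carrier G)) = ennreal (c * sum w K)"
    if "0 \<le> c" for c
  proof -
    have "(\<integral>\<^sup>+x. ennreal (c * v x) \<partial>count_space (carrier G)) = (\<Sum>x\<in>K. ennreal (c * v x))"
      by (rule nn_integral_count_space') (use K in \<open>auto simp: v_def\<close>)
    also have "\<dots> = ennreal (\<Sum>x\<in>K. c * v x)" using v that by (intro sum_ennreal) auto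
    also have "(\<Sum>x\<in>K. c * v x) = c * sum w K" by (simp add: v_def sum_distrib_left)
    finally show ?thesis .
  qed
  have FB: "finite (F <#> B)" "F <#> B \<subseteq> carrier G"
    using F by (auto intro: finite_set_mult set_mult_closed[THEN subsetD])
  have "real (card (F <#> B)) * sum w K < (1 + \<epsilon>) * real (card F) * sum w K"
    using card pos by simp
  \<comment> \<open>Writing the weight as \<open>1 * v x\<close> lets \<open>int_v\<close> evaluate
    both sides.\<close>
  then have "of_nat (card (F <#> B)) * (\<integral>\<^sup>+x. ennreal (1 * v x) \<partial>count_space (carrier G))
      < of_nat (card F) * (\<integral>\<^sup>+x. ennreal ((1 + \<epsilon>) * v x) \<partial>count_space (carrier G))"
    using \<open>0 < \<epsilon>\<close> pos int_v[of 1] int_v[of "1 + \<epsilon>"]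
    by (simp add: ennreal_of_nat_eq_real_of_nat ennreal_mult'[symmetric] ennreal_less_iff mult_ac)
  then obtain g where g: "g \<in> carrier G"
    "(\<Sum>x\<in>g <# (F <#> B). ennreal (1 * v x)) < (\<Sum>x\<in>g <# F. ennreal ((1 + \<epsilon>) * v x))"
    using exists_translate_sum_less F FB by blast
  have "finite (g <# F)" "finite (g <# (F <#> B))"
    using F FB by (auto simp: l_coset_conv_image)
  moreover from g(2) have "sum v (g <# (F <#> B)) < (1 + \<epsilon>) * sum v (g <# F)"
    using v \<open>0 < \<epsilon>\<close> by (simp add: ennreal_less_iff sum_nonneg sum_distrib_left)
  ultimately show ?thesis using that g(1) by (simp add: sum_v)
qed

text \<open>Greedy selection: keep \<open>A\<close>, the part of \<open>K\<close> in a good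
  translate of \<open>F\<close>, delete its thickening \<open>N\<close> and recurse on
  \<open>K - N\<close>. Later pieces avoid \<open>N\<close> and are therefore far from
  \<open>A\<close>; each deletion costs at most \<open>1 + \<epsilon>\<close> times the weight kept,
  and these estimates add up.\<close>

lemma sparse_family_finite_set:
  assumes F: "finite F" "F \<subseteq> carrier G"
    and card: "real (card (F <#> word_ball m)) < (1 + \<epsilon>) * real (card F)" and "0 < \<epsilon>"
    and K: "finite K" "K \<subseteq> carrier G" and w: "\<And>x. x \<in> K \<Longrightarrow> (0::real) \<le> w x"
  shows "\<exists>\<W>. disjoint \<W> \<and> \<Union>\<W> \<subseteq> K \<and> (\<forall>A\<in>\<W>. \<exists>g\<in>carrier G. A \<subseteq> g <# F) \<and>
    (\<forall>A\<in>\<W>. \<forall>B\<in>\<W>. A \<noteq> B \<longrightarrow> (\<forall>x\<in>A. \<forall>y\<in>B. real m \<le> word_dist G S x y)) \<and>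
    sum w K \<le> (1 + \<epsilon>) * sum w (\<Union>\<W>)"
  using K w
proof (induction K rule: finite_psubset_induct)
  case (psubset K)
  show ?case
  proof (cases "sum w K = 0")
    case True
    then show ?thesis by (intro exI[of _ "{}"]) (auto simp: disjoint_def)
  next
    case False
    with psubset.prems have "0 < sum w K" by (simp add: order_less_le sum_nonneg)
    then obtain g where g: "g \<in> carrier G"
      "sum w (K \<inter> (g <# (F <#> word_ball m))) < (1 + \<epsilon>) * sum w (K \<inter> (g <# F))"
      by (rule exists_translate_small_boundary[OF F finite_word_ball word_ball_carrier card \<open>0 < \<epsilon>\<close>
            psubset.prems(2) psubset.hyps psubset.prems(1), rotated])
    define A where "A = K \<inter> (g <# F)"
    define N where "N = g <# (F <#> word_ball m)"
    have AN: "A \<subseteq> N" using l_coset_subset_thickening[OF F(2)] by (auto simp: A_def N_def)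
    \<comment> \<open>A strict inequality above a non-negative number gives \<open>A\<close>
      positive weight, so \<open>K - N\<close> is strictly smaller and the induction
      applies.\<close>
    have "0 \<le> sum w (K \<inter> N)" using psubset.prems by (intro sum_nonneg) auto
    with g have "A \<noteq> {}" by (auto simp: A_def N_def)
    then have "K - N \<subset> K" using AN by (auto simp: A_def)
    moreover have "K - N \<subseteq> carrier G" "\<And>x. x \<in> K - N \<Longrightarrow> 0 \<le> w x" using psubset.prems by auto
    ultimately obtain \<W> where \<W>: "disjoint \<W>" "\<Union>\<W> \<subseteq> K - N"
      "\<forall>A\<in>\<W>. \<exists>g\<in>carrier G. A \<subseteq> g <# F"
      "\<forall>A\<in>\<W>. \<forall>B\<in>\<W>. A \<noteq> B \<longrightarrow> (\<forall>x\<in>A. \<forall>y\<in>B. real m \<le> word_dist G S x y)"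
      "sum w (K - N) \<le> (1 + \<epsilon>) * sum w (\<Union>\<W>)"
      using psubset.IH[of "K - N"] by auto
    have far: "real m \<le> word_dist G S x y" if "x \<in> A" "y \<in> B" "B \<in> \<W>" for x y B
      using word_dist_outside_l_coset[OF g(1) F(2), of x y m] that \<W>(2) psubset.prems
      by (force simp: A_def N_def)
    have "A \<inter> \<Union>\<W> = {}" using \<W>(2) AN by auto
    moreover have "finite (\<Union>\<W>)" "finite A"
      using \<W>(2) psubset.hyps by (auto simp: A_def intro: finite_subset)
    ultimately have "sum w (\<Union>(insert A \<W>)) = sum w A + sum w (\<Union>\<W>)"
      by (simp add: sum.union_disjoint)
    moreover have "sum w K = sum w (K \<inter> N) + sum w (K - N)"
      using psubset.hyps by (metis sum.Int_Diff)
    ultimately have "sum w K \<le> (1 + \<epsilon>) * sum w (\<Union>(insert A \<W>))"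
      using g(2) \<W>(5) by (simp add: A_def N_def distrib_left)
    moreover have "disjoint (insert A \<W>)"
      using \<W>(1) \<open>A \<inter> \<Union>\<W> = {}\<close> by (auto simp: disjoint_def)
    moreover have "\<forall>C\<in>insert A \<W>. \<exists>g\<in>carrier G. C \<subseteq> g <# F"
      using \<W>(3) g(1) by (auto simp: A_def)
    moreover have "\<Union>(insert A \<W>) \<subseteq> K" using \<W>(2) by (auto simp: A_def)
    moreover have "\<forall>C\<in>insert A \<W>. \<forall>B\<in>insert A \<W>. C \<noteq> B \<longrightarrow>
        (\<forall>x\<in>C. \<forall>y\<in>B. real m \<le> word_dist G S x y)"
      using \<W>(4) far commute by (metis insert_iff)
    ultimately show ?thesis by (intro exI[of _ "insert A \<W>"] conjI)
  qed
qed

text \<open>The word balls exhaust the group, so by continuity from below their measures tend to the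
  total mass, which exceeds \<open>c\<close> times itself unless it is 0.\<close>

lemma finite_measure_concentrated_on_word_ball:
  assumes \<mu>: "borel_measure_on \<mu>" "finite_measure \<mu>" and "c < 1"
  obtains n where "c * measure \<mu> (carrier G) \<le> measure \<mu> (word_ball n)"
proof (cases "measure \<mu> (carrier G) = 0")
  case True
  with that show ?thesis by simp
next
  case False
  interpret finite_measure \<mu> by fact
  have "(\<lambda>n. measure \<mu> (word_ball n)) \<longlonglongrightarrow> measure \<mu> (\<Union>n. word_ball n)"
    by (rule finite_Lim_measure_incseq)
       (auto simp: sets_borel_measure_on[OF \<mu>(1)] word_ball_def incseq_def)
  moreover have "c * measure \<mu> (carrier G) < measure \<mu> (carrier G)"
    using False \<open>c < 1\<close> by (simp add: order_less_le)
  ultimately have "eventually (\<lambda>n. c * measure \<mu> (carrier G) < measure \<mu> (word_ball n)) sequentially"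
    by (intro order_tendstoD(1)) (simp_all add: UN_word_ball)
  then show ?thesis using that by (auto simp: eventually_sequentially intro: less_imp_le)
qed

lemma metric_sparsification_if_Folner:
  assumes "Folner_condition" "0 < c" "c < 1"
  shows "metric_sparsification c"
proof -
  \<comment> \<open>Mass is lost twice, in passing to a finite ball and in sparsifying there. Each
    time the fraction \<open>b\<close> survives, \<open>\<epsilon>\<close> being chosen with
    \<open>1 / (1 + \<epsilon>) = b\<close>.\<close>
  define b where "b = sqrt c"
  have b: "0 < b" "b < 1" "b * b = c" using assms by (auto simp: b_def)
  define \<epsilon> where "\<epsilon> = 1 / b - 1"
  have \<epsilon>: "0 < \<epsilon>" "1 + \<epsilon> = 1 / b" using b by (auto simp: \<epsilon>_def)
  have "\<exists>f. mono f \<and> (\<forall>m. \<forall>\<mu>. borel_measure_on \<mu> \<and> finite_measure \<mu> \<longrightarrow>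
         (\<exists>\<W>. disjoint \<W> \<and> \<Union>\<W> \<in> sets \<mu> \<and>
           (\<forall>A\<in>\<W>. \<forall>B\<in>\<W>. A \<noteq> B \<longrightarrow> msetdist A B \<ge> of_nat m) \<and>
           (\<forall>A\<in>\<W>. mdiam A \<le> of_nat (f m)) \<and>
           measure \<mu> (\<Union>\<W>) \<ge> c * measure \<mu> (carrier G)))"
  proof (rule monotone_bound_choice, goal_cases)
    case (1 m)
    \<comment> \<open>\<open>F\<close>, and with it the diameter bound, depends on \<open>m\<close>
      and \<open>c\<close> but not on the measure.\<close>
    obtain F where F: "finite F" "F \<subseteq> carrier G"
      "real (card (F <#> word_ball m)) < (1 + \<epsilon>) * real (card F)"
      using assms(1) \<epsilon>(1) finite_word_ball word_ball_carrier unfolding Folner_condition_def by metis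
    obtain D where D: "\<And>g A. g \<in> carrier G \<Longrightarrow> A \<subseteq> g <# F \<Longrightarrow> mdiam A \<le> of_nat D"
      using finite_mdiam_l_coset_bound[OF F(1,2)] by metis
    show ?case
    proof (intro exI[of _ D] allI impI, elim conjE)
      fix \<mu> assume \<mu>: "borel_measure_on \<mu>" "finite_measure \<mu>"
      interpret finite_measure \<mu> by fact
      note sets = sets_borel_measure_on[OF \<mu>(1)]
      obtain n where n: "b * measure \<mu> (carrier G) \<le> measure \<mu> (word_ball n)"
        using finite_measure_concentrated_on_word_ball[OF \<mu> b(2)] by metis
      obtain \<W> where \<W>: "disjoint \<W>" "\<Union>\<W> \<subseteq> word_ball n"
        "\<forall>A\<in>\<W>. \<exists>g\<in>carrier G. A \<subseteq> g <# F"
        "\<forall>A\<in>\<W>. \<forall>B\<in>\<W>. A \<noteq> B \<longrightarrow> (\<forall>x\<in>A. \<forall>y\<in>B. real m \<le> word_dist G S x y)"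
        "(\<Sum>x\<in>word_ball n. measure \<mu> {x}) \<le> (1 + \<epsilon>) * (\<Sum>x\<in>\<Union>\<W>. measure \<mu> {x})"
        using sparse_family_finite_set[OF F \<epsilon>(1) finite_word_ball[of n] word_ball_carrier,
            of "\<lambda>x. measure \<mu> {x}"] by auto
      have eq: "measure \<mu> A = (\<Sum>x\<in>A. measure \<mu> {x})" if "A \<subseteq> word_ball n" for A
        using that finite_word_ball[of n] word_ball_carrier[of n]
        by (intro finite_measure_eq_sum_singleton) (auto simp: sets intro: finite_subset)
      have "b * (b * measure \<mu> (carrier G)) \<le> b * measure \<mu> (word_ball n)"
        using n b by simp
      also have "\<dots> \<le> b * ((1 + \<epsilon>) * measure \<mu> (\<Union>\<W>))"
        using \<W>(2,5) b eq[of "word_ball n"] eq[of "\<Union>\<W>"] by simp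
      also have "\<dots> = measure \<mu> (\<Union>\<W>)" using b \<epsilon>(2) by simp
      finally have "c * measure \<mu> (carrier G) \<le> measure \<mu> (\<Union>\<W>)"
        using b(3) by (simp add: mult.assoc[symmetric])
      moreover have "\<Union>\<W> \<in> sets \<mu>" using \<W>(2) word_ball_carrier[of n] by (auto simp: sets)
      moreover have "msetdist A B \<ge> of_nat m" if "A \<in> \<W>" "B \<in> \<W>" "A \<noteq> B" for A B
        unfolding msetdist_def ennreal_of_nat_eq_real_of_nat
        using \<W>(4) that by (intro INF_greatest ennreal_leI) auto
      moreover have "mdiam A \<le> of_nat D" if "A \<in> \<W>" for A using D \<W>(3) that by blast
      ultimately show "\<exists>\<W>. disjoint \<W> \<and> \<Union>\<W> \<in> sets \<mu> \<and>
           (\<forall>A\<in>\<W>. \<forall>B\<in>\<W>. A \<noteq> B \<longrightarrow> msetdist A B \<ge> of_nat m) \<and>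
           (\<forall>A\<in>\<W>. mdiam A \<le> of_nat D) \<and>
           measure \<mu> (\<Union>\<W>) \<ge> c * measure \<mu> (carrier G)"
        using \<W>(1) by (intro exI[of _ \<W>]) auto
    qed
  next
    case (2 m D D')
    have "(of_nat D :: ennreal) \<le> of_nat D'" using 2(2) by simp
    with 2(1) show ?case by (meson order_trans)
  qed
  then show ?thesis using assms by (simp add: metric_sparsification_def)
qed

text \<open>Constants are capped at 1 by definition, and all those strictly between 0 and 1 are
  available, so the supremum is 1.\<close>

lemma sparsification_number_if_Folner:
  assumes "Folner_condition"
  shows "sparsification_number = 1"
proof -
  have ms: "metric_sparsification c" if "0 < c" "c < 1" for c
    using metric_sparsification_if_Folner assms that by blast
  have le: "c \<le> 1" if "metric_sparsification c" for c
    using that by (simp add: metric_sparsification_def)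
  have "Sup {c. metric_sparsification c} = 1"
  proof (rule cSup_eq_non_empty)
    show "{c. metric_sparsification c} \<noteq> {}" using ms[of "1/2"] by auto
    fix y assume y: "\<And>x. x \<in> {c. metric_sparsification c} \<Longrightarrow> x \<le> y"
    show "1 \<le> y"
    proof (rule dense_le_bounded[of 0])
      fix c :: real assume "0 < c" "c < 1"
      then show "c \<le> y" using ms y by auto
    qed simp
  qed (use le in auto)
  then show ?thesis using ms[of "1/2"] by (auto simp: sparsification_number_def)
qed


section \<open>Operator norm localization\<close>

lemma borel_measurable_borel_measure_on:
  assumes "borel_measure_on \<nu>"
  shows "f \<in> borel_measurable \<nu>"
  using assms sets_borel_measure_on[OF assms] by (auto simp: measurable_def borel_measure_on_def)

lemma L2_fun_zero_outside:
  assumes "borel_measure_on \<nu>" "\<phi> \<in> L2_fun \<nu>"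
  shows "(\<lambda>x. if x \<in> A then \<phi> x else 0) \<in> L2_fun \<nu>"
proof -
  note [simp] = borel_measurable_borel_measure_on[OF assms(1)]
  have "integrable \<nu> (\<lambda>x. (norm (\<phi> x))\<^sup>2)" using assms(2) by (simp add: L2_fun_def)
  then have "integrable \<nu> (\<lambda>x. (norm (if x \<in> A then \<phi> x else 0))\<^sup>2)"
    by (rule Bochner_Integration.integrable_bound) auto
  then show ?thesis by (simp add: L2_fun_def)
qed

text \<open>In the discrete topology the complement of \<open>A\<close> is open, hence among the
  null sets removed in forming the support.\<close>

lemma L2_support_zero_outside:
  assumes "A \<subseteq> carrier G"
  shows "L2_support \<nu> (\<lambda>x. if x \<in> A then \<phi> x else 0) \<subseteq> A"
proof -
  have "carrier G - A \<in> {U. openin mtopology U \<and>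
      (AE x in \<nu>. x \<in> U \<longrightarrow> (if x \<in> A then \<phi> x else 0) = 0)}"
    by (auto simp: openin_word_metric)
  then show ?thesis unfolding L2_support_def by blast
qed

lemma nn_integral_norm_square_L2:
  assumes "\<phi> \<in> L2_fun \<nu>"
  shows "(\<integral>\<^sup>+x. ennreal ((norm (\<phi> x))\<^sup>2) \<partial>\<nu>) = ennreal ((L2_norm \<nu> \<phi>)\<^sup>2)"
proof -
  have "integrable \<nu> (\<lambda>x. (norm (\<phi> x))\<^sup>2)" using assms by (simp add: L2_fun_def)
  then show ?thesis
    by (subst nn_integral_eq_integral) (auto simp: L2_norm_def)
qed

text \<open>Links the norm of a cut-off function to a finite sum of point weights, the form in which
  averaging over translates delivers its inequality.\<close>

lemma sum_norm_square_L2: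
  assumes "borel_measure_on \<nu>" "\<phi> \<in> L2_fun \<nu>" "finite A" "A \<subseteq> carrier G"
  shows "(\<Sum>x\<in>A. emeasure \<nu> {x} * ennreal ((norm (\<phi> x))\<^sup>2))
    = ennreal ((L2_norm \<nu> (\<lambda>x. if x \<in> A then \<phi> x else 0))\<^sup>2)"
proof -
  have "ennreal ((L2_norm \<nu> (\<lambda>x. if x \<in> A then \<phi> x else 0))\<^sup>2)
      = (\<integral>\<^sup>+x. ennreal ((norm (if x \<in> A then \<phi> x else 0))\<^sup>2) \<partial>\<nu>)"
    by (rule nn_integral_norm_square_L2[symmetric]) (rule L2_fun_zero_outside[OF assms(1,2)])
  also have "\<dots> = (\<integral>\<^sup>+x. emeasure \<nu> {x} * ennreal ((norm (if x \<in> A then \<phi> x else 0))\<^sup>2)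
      \<partial>count_space (carrier G))"
    by (rule nn_integral_countable_discrete[OF countable_carrier sets_borel_measure_on[OF assms(1)]])
  also have "\<dots> = (\<Sum>x\<in>A. emeasure \<nu> {x} * ennreal ((norm (if x \<in> A then \<phi> x else 0))\<^sup>2))"
    by (rule nn_integral_count_space') (use assms in auto)
  finally show ?thesis by simp
qed

lemma cinner_zero_right: "cinner x 0 = 0"
  using cinner_add_left[of 0 0 x] cinner_commute[of x 0] by simp

text \<open>Split \<open>\<phi>\<close> into \<open>\<phi>1\<close> on the thickening
  \<open>N\<close> and \<open>\<phi>2\<close> off it, and test \<open>T \<phi>2\<close> against its
  own restriction \<open>\<psi>\<close> to \<open>g <# F\<close>. The supports are more than
  \<open>k\<close> apart, so the inner product, which is the squared norm of \<open>\<psi>\<close>,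
  vanishes.\<close>

lemma finite_propagation_local:
  assumes \<nu>: "borel_measure_on \<nu>" and T: "T \<in> finite_propagation_operators (real k) \<nu>"
    and \<phi>: "\<phi> \<in> L2_fun \<nu>" and F: "F \<subseteq> carrier G" and g: "g \<in> carrier G"
  shows "AE x in \<nu>. x \<in> g <# F \<longrightarrow>
    T \<phi> x = T (\<lambda>x. if x \<in> g <# (F <#> word_ball k) then \<phi> x else 0) x"
proof -
  define N where "N = g <# (F <#> word_ball k)"
  define \<phi>1 where "\<phi>1 = (\<lambda>x. if x \<in> N then \<phi> x else 0)"
  define \<phi>2 where "\<phi>2 = (\<lambda>x. if x \<in> carrier G - N then \<phi> x else 0)"
  define \<psi> where "\<psi> = (\<lambda>x. if x \<in> g <# F then T \<phi>2 x else 0)"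
  have T_op: "L2_operator \<nu> T" using T by (simp add: finite_propagation_operators_def)
  have space: "space \<nu> = carrier G" using \<nu> by (simp add: borel_measure_on_def)
  have L2: "\<phi>1 \<in> L2_fun \<nu>" "\<phi>2 \<in> L2_fun \<nu>"
    unfolding \<phi>1_def \<phi>2_def by (rule L2_fun_zero_outside[OF \<nu> \<phi>])+
  then have "T \<phi>2 \<in> L2_fun \<nu>" using T_op by (simp add: L2_operator_def)
  then have \<psi>: "\<psi> \<in> L2_fun \<nu>" unfolding \<psi>_def by (rule L2_fun_zero_outside[OF \<nu>])
  have "g <# F \<subseteq> carrier G" using F g by (auto simp: l_coset_def)
  then have supp: "L2_support \<nu> \<phi>2 \<subseteq> carrier G - N" "L2_support \<nu> \<psi> \<subseteq> g <# F"
    unfolding \<phi>2_def \<psi>_def by (intro L2_support_zero_outside; simp)+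
  have "ennreal (real k) < ennreal (real k + 1)" by (simp add: ennreal_less_iff)
  also have "\<dots> \<le> msetdist (L2_support \<nu> \<phi>2) (L2_support \<nu> \<psi>)"
    unfolding msetdist_def
  proof (intro INF_greatest ennreal_leI)
    fix y x assume "y \<in> L2_support \<nu> \<phi>2" "x \<in> L2_support \<nu> \<psi>"
    then have "real k + 1 \<le> word_dist G S x y"
      using supp unfolding N_def by (intro word_dist_outside_l_coset[OF g F]) auto
    then show "real k + 1 \<le> word_dist G S y x" by (simp add: commute)
  qed
  finally have "L2_inner \<nu> (T \<phi>2) \<psi> = 0"
    using T L2 \<psi> by (auto simp: finite_propagation_operators_def propagation_at_most_def)
  moreover have "cinner (T \<phi>2 x) (\<psi> x) = complex_of_real ((norm (\<psi> x))\<^sup>2)" for x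
    by (simp add: \<psi>_def cinner_self cinner_zero_right)
  ultimately have "complex_of_real (\<integral>x. (norm (\<psi> x))\<^sup>2 \<partial>\<nu>) = 0"
    unfolding L2_inner_def by (simp only: integral_complex_of_real)
  then have "(\<integral>x. (norm (\<psi> x))\<^sup>2 \<partial>\<nu>) = 0" by (simp only: of_real_eq_0_iff)
  then have "AE x in \<nu>. (norm (\<psi> x))\<^sup>2 = 0"
    using \<psi> by (subst (asm) integral_nonneg_eq_0_iff_AE) (auto simp: L2_fun_def)
  moreover have "AE x in \<nu>. T (\<lambda>y. \<phi>1 y + \<phi>2 y) x = T \<phi>1 x + T \<phi>2 x"
    using T_op L2 by (simp add: L2_operator_def)
  \<comment> \<open>The sum of the two parts is \<open>\<phi>\<close> on the carrier but may differ
    from it elsewhere on the type, so the step uses that \<open>T\<close> respects equality almost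
    everywhere.\<close>
  moreover have "AE x in \<nu>. T (\<lambda>y. \<phi>1 y + \<phi>2 y) x = T \<phi> x"
  proof -
    have sum: "(\<lambda>y. \<phi>1 y + \<phi>2 y) = (\<lambda>x. if x \<in> N \<union> carrier G then \<phi> x else 0)"
      by (auto simp: \<phi>1_def \<phi>2_def)
    have "(\<lambda>y. \<phi>1 y + \<phi>2 y) \<in> L2_fun \<nu>"
      unfolding sum by (rule L2_fun_zero_outside[OF \<nu> \<phi>])
    moreover have "AE x in \<nu>. \<phi>1 x + \<phi>2 x = \<phi> x"
      by (rule AE_I2) (auto simp: \<phi>1_def \<phi>2_def space)
    moreover have "\<forall>\<phi>\<in>L2_fun \<nu>. \<forall>\<psi>\<in>L2_fun \<nu>.
        (AE x in \<nu>. \<phi> x = \<psi> x) \<longrightarrow> (AE x in \<nu>. T \<phi> x = T \<psi> x)"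
      using T_op by (simp add: L2_operator_def)
    ultimately show ?thesis using \<phi> by (elim ballE[of _ _ "\<lambda>y. \<phi>1 y + \<phi>2 y"] ballE[of _ _ \<phi>]) auto
  qed
  ultimately have "AE x in \<nu>. x \<in> g <# F \<longrightarrow> T \<phi> x = T \<phi>1 x"
    by eventually_elim (auto simp: \<psi>_def)
  then show ?thesis by (simp add: \<phi>1_def N_def)
qed

text \<open>Averaging compares two weights here: a multiple of \<open>|\<phi>|^2\<close> on the
  thickening \<open>E\<close> and \<open>|T \<phi>|^2\<close> on \<open>F\<close>. By locality
  \<open>T \<phi>\<close> may be replaced on \<open>g <# F\<close> by \<open>T \<psi>\<close>, where
  \<open>\<psi>\<close> is \<open>\<phi>\<close> cut off to \<open>g <# E\<close>.\<close>

lemma localized_near_maximizer: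
  assumes \<nu>: "borel_measure_on \<nu>" and T: "T \<in> finite_propagation_operators (real k) \<nu>"
    and F: "finite F" "F \<subseteq> carrier G" and card: "real (card (F <#> word_ball k)) < 2 * real (card F)"
    and pos: "0 < L2_onorm \<nu> T"
  shows "\<exists>\<phi>\<in>L2_fun \<nu>. \<not> (AE x in \<nu>. \<phi> x = 0) \<and>
    (\<exists>g\<in>carrier G. L2_support \<nu> \<phi> \<subseteq> g <# (F <#> word_ball k)) \<and>
    1/2 * L2_onorm \<nu> T * L2_norm \<nu> \<phi> \<le> L2_norm \<nu> (T \<phi>)"
proof -
  let ?o = "L2_onorm \<nu> T" and ?cs = "count_space (carrier G)"
  define E where "E = F <#> word_ball k"
  have E: "finite E" "E \<subseteq> carrier G"
    unfolding E_def
    by (rule finite_set_mult[OF F(1) finite_word_ball], rule set_mult_closed[OF F(2) word_ball_carrier])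
  have T_op: "L2_operator \<nu> T" using T by (simp add: finite_propagation_operators_def)
  have TL2: "T \<phi> \<in> L2_fun \<nu>" if "\<phi> \<in> L2_fun \<nu>" for \<phi>
    using T_op that by (simp add: L2_operator_def)
  have "(\<lambda>x. 0) \<in> L2_fun \<nu>" by (simp add: L2_fun_def)
  then have ne: "L2_fun \<nu> \<noteq> {}" by blast
  \<comment> \<open>The square 9/16 of 3/4 must exceed 1/2, which is 1/4 from the target constant
    times the factor 2 lost in \<open>card\<close>.\<close>
  have "3/4 * ?o < (SUP \<phi>\<in>L2_fun \<nu>. L2_norm \<nu> (T \<phi>) / L2_norm \<nu> \<phi>)"
    using pos by (simp add: L2_onorm_def)
  then obtain \<phi> where \<phi>: "\<phi> \<in> L2_fun \<nu>" and big: "3/4 * ?o < L2_norm \<nu> (T \<phi>) / L2_norm \<nu> \<phi>"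
    using less_cSupD[of "(\<lambda>\<phi>. L2_norm \<nu> (T \<phi>) / L2_norm \<nu> \<phi>) ` L2_fun \<nu>" "3/4 * ?o"] ne by blast
  define p q where "p = L2_norm \<nu> \<phi>" and "q = L2_norm \<nu> (T \<phi>)"
  have "0 \<le> p" by (simp add: p_def L2_norm_nonneg)
  \<comment> \<open>Division by zero yields 0, so \<open>p = 0\<close> would contradict
    \<open>big\<close>.\<close>
  moreover have "p \<noteq> 0" using big pos by (auto simp: p_def)
  ultimately have p: "0 < p" by simp
  then have "3/4 * ?o * p < q" using big by (simp add: p_def q_def pos_less_divide_eq)
  then have "(3/4 * ?o * p)\<^sup>2 < q\<^sup>2" using p pos by (intro power_strict_mono) auto
  then have pq: "9/16 * (?o\<^sup>2 * p\<^sup>2) < q\<^sup>2" by (simp add: power2_eq_square mult_ac)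
  \<comment> \<open>The square of the target stretching factor, half the operator norm.\<close>
  define c where "c = 1/4 * ?o\<^sup>2"
  have c: "0 \<le> c" by (simp add: c_def)
  define w where "w x = ennreal c * (emeasure \<nu> {x} * ennreal ((norm (\<phi> x))\<^sup>2))" for x
  define u where "u x = emeasure \<nu> {x} * ennreal ((norm (T \<phi> x))\<^sup>2)" for x
  note discrete = nn_integral_countable_discrete[OF countable_carrier sets_borel_measure_on[OF \<nu>]]
  have "(\<integral>\<^sup>+x. w x \<partial>?cs) = ennreal (c * p\<^sup>2)"
    unfolding w_def using c nn_integral_norm_square_L2[OF \<phi>]
    by (subst nn_integral_cmult) (auto simp: discrete[symmetric] p_def ennreal_mult)
  moreover have "(\<integral>\<^sup>+x. u x \<partial>?cs) = ennreal (q\<^sup>2)"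
    unfolding u_def using nn_integral_norm_square_L2[OF TL2[OF \<phi>]]
    by (simp add: discrete[symmetric] q_def)
  moreover have "real (card E) * (c * p\<^sup>2) < real (card F) * q\<^sup>2"
  proof -
    have "real (card E) * (c * p\<^sup>2) \<le> 2 * real (card F) * (c * p\<^sup>2)"
      using card c by (intro mult_right_mono) (auto simp: E_def)
    also have "\<dots> = real (card F) * (1/2 * (?o\<^sup>2 * p\<^sup>2))" by (simp add: c_def)
    also have "\<dots> < real (card F) * q\<^sup>2"
    proof (rule mult_strict_left_mono)
      have "0 \<le> ?o\<^sup>2 * p\<^sup>2" by simp
      with pq show "1/2 * (?o\<^sup>2 * p\<^sup>2) < q\<^sup>2" by linarith
      show "0 < real (card F)" using card of_nat_0_le_iff[of "card (F <#> word_ball k)"] by linarith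
    qed
    finally show ?thesis .
  qed
  ultimately have "of_nat (card E) * (\<integral>\<^sup>+x. w x \<partial>?cs) < of_nat (card F) * (\<integral>\<^sup>+x. u x \<partial>?cs)"
    using c by (simp add: ennreal_of_nat_eq_real_of_nat ennreal_mult'[symmetric] ennreal_less_iff)
  then obtain g where g: "g \<in> carrier G" "sum w (g <# E) < sum u (g <# F)"
    using exists_translate_sum_less F E by blast
  have fin: "finite (g <# F)" "finite (g <# E)" "g <# F \<subseteq> carrier G" "g <# E \<subseteq> carrier G"
    using F E g(1) by (auto simp: l_coset_conv_image)
  define \<psi> where "\<psi> = (\<lambda>x. if x \<in> g <# E then \<phi> x else 0)"
  have \<psi>: "\<psi> \<in> L2_fun \<nu>" unfolding \<psi>_def by (rule L2_fun_zero_outside[OF \<nu> \<phi>])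
  have "sum w (g <# E) = ennreal (c * (L2_norm \<nu> \<psi>)\<^sup>2)"
    using c sum_norm_square_L2[OF \<nu> \<phi> fin(2,4)]
    by (simp add: w_def sum_distrib_left[symmetric] \<psi>_def ennreal_mult)
  moreover have "sum u (g <# F) \<le> ennreal ((L2_norm \<nu> (T \<psi>))\<^sup>2)"
  proof -
    have "sum u (g <# F) = (\<integral>\<^sup>+x. ennreal ((norm (if x \<in> g <# F then T \<phi> x else 0))\<^sup>2) \<partial>\<nu>)"
      unfolding u_def sum_norm_square_L2[OF \<nu> TL2[OF \<phi>] fin(1,3)]
      by (rule nn_integral_norm_square_L2[symmetric]) (rule L2_fun_zero_outside[OF \<nu> TL2[OF \<phi>]])
    also have "\<dots> \<le> (\<integral>\<^sup>+x. ennreal ((norm (T \<psi> x))\<^sup>2) \<partial>\<nu>)"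
      using finite_propagation_local[OF \<nu> T \<phi> F(2) g(1)]
      by (intro nn_integral_mono_AE) (auto simp: \<psi>_def E_def)
    finally show ?thesis by (simp add: nn_integral_norm_square_L2 TL2 \<psi>)
  qed
  ultimately have "ennreal (c * (L2_norm \<nu> \<psi>)\<^sup>2) < ennreal ((L2_norm \<nu> (T \<psi>))\<^sup>2)"
    using g(2) by simp
  then have less: "(1/2 * ?o * L2_norm \<nu> \<psi>)\<^sup>2 < (L2_norm \<nu> (T \<psi>))\<^sup>2"
    using c by (simp add: ennreal_less_iff c_def power_mult_distrib power_divide)
  have "1/2 * ?o * L2_norm \<nu> \<psi> < L2_norm \<nu> (T \<psi>)"
    using power_less_imp_less_base[OF less] L2_norm_nonneg by blast
  \<comment> \<open>Were \<open>\<psi>\<close> null, boundedness of \<open>T\<close> would force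
    \<open>T \<psi>\<close> to have norm 0, against the strict inequality
    \<open>less\<close>.\<close>
  moreover have "\<not> (AE x in \<nu>. \<psi> x = 0)"
  proof
    assume "AE x in \<nu>. \<psi> x = 0"
    then have "AE x in \<nu>. (norm (\<psi> x))\<^sup>2 = 0" by eventually_elim simp
    then have "(\<integral>x. (norm (\<psi> x))\<^sup>2 \<partial>\<nu>) = 0" by (rule integral_eq_zero_AE)
    then have "L2_norm \<nu> \<psi> = 0" by (simp add: L2_norm_def)
    moreover obtain C where "L2_norm \<nu> (T \<psi>) \<le> C * L2_norm \<nu> \<psi>"
      using T_op \<psi> unfolding L2_operator_def by blast
    ultimately have "L2_norm \<nu> (T \<psi>) \<le> 0" by simp
    with less L2_norm_nonneg[of \<nu> "T \<psi>"] show False by simp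
  qed
  moreover have "L2_support \<nu> \<psi> \<subseteq> g <# E"
    unfolding \<psi>_def by (rule L2_support_zero_outside[OF fin(4)])
  ultimately show ?thesis using \<psi> g(1) unfolding E_def by (intro bexI[of _ \<psi>]) auto
qed

text \<open>A nonzero measure on a countable set charges some point, and local finiteness makes that
  mass finite, so \<open>h\<close> placed there is square-integrable and nonzero. This serves
  operators whose norm is not positive.\<close>

lemma exists_nonzero_L2_singleton_support:
  fixes h :: "'h::{complex_hilbert_space, second_countable_topology}"
  assumes \<nu>: "borel_measure_on \<nu>" "locally_finite_measure \<nu>" "emeasure \<nu> (carrier G) \<noteq> 0"
    and "h \<noteq> 0"
  obtains \<phi> :: "'a \<Rightarrow> 'h" and g where "\<phi> \<in> L2_fun \<nu>" "\<not> (AE x in \<nu>. \<phi> x = 0)"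
    "g \<in> carrier G" "L2_support \<nu> \<phi> \<subseteq> {g}"
proof -
  note sets = sets_borel_measure_on[OF \<nu>(1)]
  have "\<exists>g\<in>carrier G. emeasure \<nu> {g} \<noteq> 0"
  proof (rule ccontr)
    assume "\<not> ?thesis"
    then have "(\<integral>\<^sup>+x. emeasure \<nu> {x} \<partial>count_space (carrier G)) = (\<integral>\<^sup>+x. 0 \<partial>count_space (carrier G))"
      by (intro nn_integral_cong) auto
    with \<nu>(3) emeasure_countable_singleton[of "carrier G" \<nu>] countable_carrier show False
      by (simp add: sets)
  qed
  then obtain g where g: "g \<in> carrier G" "emeasure \<nu> {g} \<noteq> 0" by blast
  have "mbounded {g}" using g by (simp add: mbounded_insert)
  then have fin: "emeasure \<nu> {g} < \<infinity>" using \<nu>(2) g by (simp add: locally_finite_measure_def sets)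
  define \<phi> where "\<phi> = (\<lambda>x. if x \<in> {g} then h else 0)"
  have eq: "(norm (\<phi> x))\<^sup>2 = (norm h)\<^sup>2 * indicator {g} x" for x by (simp add: \<phi>_def)
  have "integrable \<nu> (\<lambda>x. (norm (\<phi> x))\<^sup>2)"
    unfolding eq using fin g by (intro integrable_mult_right integrable_real_indicator) (auto simp: sets)
  moreover have "\<phi> \<in> borel_measurable \<nu>"
    by (rule borel_measurable_borel_measure_on[OF \<nu>(1)])
  ultimately have "\<phi> \<in> L2_fun \<nu>" by (simp add: L2_fun_def)
  moreover have "\<not> (AE x in \<nu>. \<phi> x = 0)"
  proof
    assume "AE x in \<nu>. \<phi> x = 0"
    then have "emeasure \<nu> {x \<in> space \<nu>. \<phi> x \<noteq> 0} = 0"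
      by (subst (asm) AE_iff_measurable[OF _ refl]) (auto simp: sets \<nu>(1)[unfolded borel_measure_on_def])
    moreover have "{x \<in> space \<nu>. \<phi> x \<noteq> 0} = {g}"
      using g \<open>h \<noteq> 0\<close> \<nu>(1) by (auto simp: \<phi>_def borel_measure_on_def)
    ultimately show False using g by simp
  qed
  moreover have "L2_support \<nu> \<phi> \<subseteq> {g}"
    unfolding \<phi>_def by (rule L2_support_zero_outside) (use g in auto)
  ultimately show ?thesis using that g by blast
qed

text \<open>The Folner set is chosen from \<open>k\<close> alone, so one diameter bound serves all
  measures and operators. The vector \<open>h\<close> witnesses that the Hilbert space is not
  zero.\<close>

lemma operator_norm_localization_if_Folner:
  fixes h :: "'h::{complex_hilbert_space, second_countable_topology}"
  assumes "Folner_condition" "h \<noteq> 0"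
  shows "operator_norm_localization TYPE('h)"
proof -
  have "\<exists>f. mono f \<and> (\<forall>k. \<forall>\<nu>. borel_measure_on \<nu> \<and> locally_finite_measure \<nu> \<and>
      emeasure \<nu> (carrier G) \<noteq> 0 \<longrightarrow>
         (\<forall>T \<in> (finite_propagation_operators (real k) \<nu> :: (('a \<Rightarrow> 'h) \<Rightarrow> ('a \<Rightarrow> 'h)) set).
           \<exists>\<phi>\<in>L2_fun \<nu>. \<not> (AE x in \<nu>. \<phi> x = 0) \<and>
             mdiam (L2_support \<nu> \<phi>) \<le> of_nat (f k) \<and>
             L2_norm \<nu> (T \<phi>) \<ge> 1/2 * L2_onorm \<nu> T * L2_norm \<nu> \<phi>))"
  proof (rule monotone_bound_choice, goal_cases)
    case (1 k)
    obtain F where F: "finite F" "F \<subseteq> carrier G"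
      "real (card (F <#> word_ball k)) < 2 * real (card F)"
    proof -
      \<comment> \<open>Here \<epsilon> = 1; a doubling of the cardinality is affordable for the
        constant 1/2.\<close>
      have "\<exists>F. finite F \<and> F \<subseteq> carrier G \<and>
          real (card (F <#> word_ball k)) < (1 + 1) * real (card F)"
        using assms(1) finite_word_ball word_ball_carrier unfolding Folner_condition_def
        by (metis zero_less_one)
      then show ?thesis using that by auto
    qed
    define E where "E = F <#> word_ball k"
    have E: "finite E" "E \<subseteq> carrier G"
      unfolding E_def
      by (rule finite_set_mult[OF F(1) finite_word_ball], rule set_mult_closed[OF F(2) word_ball_carrier])
    obtain D where D: "\<And>g A. g \<in> carrier G \<Longrightarrow> A \<subseteq> g <# E \<Longrightarrow> mdiam A \<le> of_nat D"
      using finite_mdiam_l_coset_bound[OF E] by metis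
    show ?case
    proof (intro exI[of _ D] allI impI ballI, elim conjE)
      fix \<nu> :: "'a measure" and T :: "('a \<Rightarrow> 'h) \<Rightarrow> 'a \<Rightarrow> 'h"
      assume T: "T \<in> finite_propagation_operators (real k) \<nu>"
        and \<nu>: "borel_measure_on \<nu>" "locally_finite_measure \<nu>" "emeasure \<nu> (carrier G) \<noteq> 0"
      show "\<exists>\<phi>\<in>L2_fun \<nu>. \<not> (AE x in \<nu>. \<phi> x = 0) \<and>
             mdiam (L2_support \<nu> \<phi>) \<le> of_nat D \<and>
             L2_norm \<nu> (T \<phi>) \<ge> 1/2 * L2_onorm \<nu> T * L2_norm \<nu> \<phi>"
      proof (cases "0 < L2_onorm \<nu> T")
        case True
        then show ?thesis using localized_near_maximizer[OF \<nu>(1) T F] D unfolding E_def by meson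
      next
        case False
        \<comment> \<open>The required lower bound is now at most 0, so any nonzero function
          supported at a point will do.\<close>
        obtain \<phi> :: "'a \<Rightarrow> 'h" and g where \<phi>: "\<phi> \<in> L2_fun \<nu>" "\<not> (AE x in \<nu>. \<phi> x = 0)"
          "g \<in> carrier G" "L2_support \<nu> \<phi> \<subseteq> {g}"
          using exists_nonzero_L2_singleton_support[OF \<nu> assms(2)] by metis
        have "mdiam (L2_support \<nu> \<phi>) \<le> of_nat D"
          unfolding mdiam_def
        proof (intro SUP_least)
          fix x y assume "x \<in> L2_support \<nu> \<phi>" "y \<in> L2_support \<nu> \<phi>"
          then have "x = g" "y = g" using \<phi>(4) by auto
          then show "ennreal (word_dist G S x y) \<le> of_nat D" using \<phi>(3) by simp
        qed
        moreover have "1/2 * L2_onorm \<nu> T * L2_norm \<nu> \<phi> \<le> 0"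
          using False L2_norm_nonneg[of \<nu> \<phi>] by (simp add: mult_nonpos_nonneg)
        then have "1/2 * L2_onorm \<nu> T * L2_norm \<nu> \<phi> \<le> L2_norm \<nu> (T \<phi>)"
          using L2_norm_nonneg[of \<nu> "T \<phi>"] by linarith
        ultimately show ?thesis using \<phi> by blast
      qed
    qed
  next
    case (2 k D D')
    have "(of_nat D :: ennreal) \<le> of_nat D'" using 2(2) by simp
    with 2(1) show ?case by (meson order_trans)
  qed
  then have "operator_norm_localization_with TYPE('h) (1/2)"
    unfolding operator_norm_localization_with_def by (simp, blast)
  then show ?thesis unfolding operator_norm_localization_def by blast
qed

end


section \<open>Folner sets of the wreath product\<close>

text \<open>Lamp configurations confined to \<open>I\<close>. Values off \<open>I\<close> are 0, not
  \<open>undefined\<close> as in \<open>I \<rightarrow>\<^sub>E V\<close>, so that these functions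
  lie in the direct sum.\<close>

definition boxed :: "int set \<Rightarrow> int set \<Rightarrow> (int \<Rightarrow> int) set" where
  "boxed I V = {f. (\<forall>i\<in>I. f i \<in> V) \<and> (\<forall>i. i \<notin> I \<longrightarrow> f i = 0)}"

lemma boxed_bij: "bij_betw (\<lambda>f. restrict f I) (boxed I V) (I \<rightarrow>\<^sub>E V)"
  by (rule bij_betw_byWitness[where f' = "\<lambda>f i. if i \<in> I then f i else 0"])
     (auto simp: boxed_def PiE_def extensional_def fun_eq_iff)

lemma card_boxed: "finite I \<Longrightarrow> card (boxed I V) = card V ^ card I"
  using bij_betw_same_card[OF boxed_bij] by (simp add: card_PiE)

lemma finite_boxed: "finite I \<Longrightarrow> finite V \<Longrightarrow> finite (boxed I V)"
  using bij_betw_finite[OF boxed_bij] by (simp add: finite_PiE)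

lemma boxed_finite_support: "finite I \<Longrightarrow> f \<in> boxed I V \<Longrightarrow> finite {i. f i \<noteq> 0}"
  by (rule finite_subset[of _ I]) (auto simp: boxed_def)

lemma finite_subset_wreath_Z_Z_bounded:
  assumes "finite B" "B \<subseteq> carrier wreath_Z_Z"
  obtains L :: nat where "\<And>f m. (f, m) \<in> B \<Longrightarrow> \<bar>m\<bar> \<le> int L"
    "\<And>f m i. (f, m) \<in> B \<Longrightarrow> \<bar>f i\<bar> \<le> int L"
    "\<And>f m i. (f, m) \<in> B \<Longrightarrow> f i \<noteq> 0 \<Longrightarrow> \<bar>i\<bar> \<le> int L"
proof -
  have *: "\<exists>L. \<forall>a\<in>A. nat \<bar>a\<bar> \<le> L" if "finite A" for A :: "int set"
    using that finite_nat_set_iff_bounded_le[of "(\<lambda>a. nat \<bar>a\<bar>) ` A"] by auto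
  have supp: "finite {i. fst b i \<noteq> 0}" if "b \<in> B" for b
    using that assms(2) by (auto simp: carrier_wreath_Z_Z)
  define A where "A = snd ` B \<union> (\<Union>b\<in>B. {i. fst b i \<noteq> 0}) \<union> (\<Union>b\<in>B. fst b ` {i. fst b i \<noteq> 0})"
  have "finite A" using assms(1) supp by (auto simp: A_def)
  then obtain L where "\<And>a. a \<in> A \<Longrightarrow> nat \<bar>a\<bar> \<le> L" using * by blast
  then have L: "\<And>a. a \<in> A \<Longrightarrow> \<bar>a\<bar> \<le> int L" by (simp add: nat_le_iff)
  show ?thesis
  proof
    fix f m assume b: "(f, m) \<in> B"
    then show "\<bar>m\<bar> \<le> int L" by (intro L) (force simp: A_def)
    fix i
    show "\<bar>i\<bar> \<le> int L" if "f i \<noteq> 0" using b that by (intro L) (force simp: A_def)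
    show "\<bar>f i\<bar> \<le> int L"
    proof (cases "f i = 0")
      case False
      then show ?thesis using b by (intro L) (force simp: A_def)
    qed simp
  qed
qed

text \<open>An element is a lamp configuration with a cursor. \<open>F\<close> has cursors in
  \<open>[0, n)\<close> and lamps on \<open>I\<close> with values in \<open>[0, N)\<close>.
  Multiplying by \<open>B\<close> moves the cursor by at most \<open>L\<close> and changes lamps
  within \<open>L\<close> of it by at most \<open>L\<close>, so each range grows by
  \<open>2 * L\<close>.\<close>

lemma Folner_condition_wreath_Z_Z: "group.Folner_condition wreath_Z_Z"
  unfolding group.Folner_condition_def[OF group_wreath_Z_Z]
proof (intro allI impI)
  fix B :: "((int \<Rightarrow> int) \<times> int) set" and \<epsilon> :: real
  assume B: "finite B" "B \<subseteq> carrier wreath_Z_Z" and \<epsilon>: "0 < \<epsilon>"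
  obtain L :: nat where L: "\<And>f m. (f, m) \<in> B \<Longrightarrow> \<bar>m\<bar> \<le> int L"
    "\<And>f m i. (f, m) \<in> B \<Longrightarrow> \<bar>f i\<bar> \<le> int L"
    "\<And>f m i. (f, m) \<in> B \<Longrightarrow> f i \<noteq> 0 \<Longrightarrow> \<bar>i\<bar> \<le> int L"
    using finite_subset_wreath_Z_Z_bounded[OF B] by metis
  \<comment> \<open>The order of choices matters: \<open>n\<close> controls the cursor range and
    fixes \<open>I\<close>; only then is \<open>N\<close> taken so large that the lamp factor to the
    power \<open>card I\<close> is close to 1.\<close>
  obtain n :: nat where n: "2 * real L / \<epsilon> < real n" using reals_Archimedean2 by blast
  then have n': "real n + 2 * real L < (1 + \<epsilon>) * real n"
    using \<epsilon> by (simp add: divide_less_eq algebra_simps)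
  \<comment> \<open>The margin \<open>L\<close> on both sides contains every lamp that
    \<open>B\<close> can reach from a cursor in \<open>[0, n)\<close>.\<close>
  define I where "I = {- int L..int n + int L}"
  have "(\<lambda>N. (1 + 2 * real L / real N) ^ card I * (real n + 2 * real L))
      \<longlonglongrightarrow> (1 + 0) ^ card I * (real n + 2 * real L)"
    by (intro tendsto_intros lim_const_over_n)
  then have "eventually (\<lambda>N. (1 + 2 * real L / real N) ^ card I * (real n + 2 * real L)
      < (1 + \<epsilon>) * real n) sequentially"
    using n' by (intro order_tendstoD(2)) auto
  then have "eventually (\<lambda>N. 0 < N \<and> (1 + 2 * real L / real N) ^ card I * (real n + 2 * real L)
      < (1 + \<epsilon>) * real n) sequentially"
    using eventually_gt_at_top[of 0] by eventually_elim simp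
  then obtain N :: nat where N: "0 < N"
    "(1 + 2 * real L / real N) ^ card I * (real n + 2 * real L) < (1 + \<epsilon>) * real n"
    by (auto simp: eventually_sequentially)
  define F where "F = boxed I {0..<int N} \<times> {0..<int n}"
  define F' where "F' = boxed I {- int L..<int N + int L} \<times> {- int L..<int n + int L}"
  have cards: "real (card F) = real N ^ card I * real n"
    "real (card F') = (real N + 2 * real L) ^ card I * (real n + 2 * real L)"
    by (simp_all add: F_def F'_def card_cartesian_product card_boxed I_def nat_add_distrib add.commute)
  have "F <#>\<^bsub>wreath_Z_Z\<^esub> B \<subseteq> F'"
  proof
    fix x assume "x \<in> F <#>\<^bsub>wreath_Z_Z\<^esub> B"
    then obtain f m g l where fm: "(f, m) \<in> F" and gl: "(g, l) \<in> B"
      and x: "x = (\<lambda>i. f i + g (i - m), m + l)"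
      by (auto simp: set_mult_def mult_wreath_Z_Z)
    have "f i + g (i - m) = 0" if "i \<notin> I" for i
      using that fm L(3)[OF gl, of "i - m"] by (fastforce simp: F_def boxed_def I_def)
    moreover have "f i + g (i - m) \<in> {- int L..<int N + int L}" if "i \<in> I" for i
      using that fm L(2)[OF gl, of "i - m"] by (fastforce simp: F_def boxed_def)
    moreover have "m + l \<in> {- int L..<int n + int L}"
      using fm L(1)[OF gl] by (auto simp: F_def)
    ultimately show "x \<in> F'" by (auto simp: x F'_def boxed_def)
  qed
  moreover have "finite F'" by (simp add: F'_def I_def finite_boxed)
  ultimately have "real (card (F <#>\<^bsub>wreath_Z_Z\<^esub> B)) \<le> real (card F')"
    by (simp add: card_mono)
  also have "\<dots> = real N ^ card I * ((1 + 2 * real L / real N) ^ card I * (real n + 2 * real L))"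
  proof -
    have "real N + 2 * real L = real N * (1 + 2 * real L / real N)"
      using N(1) by (simp add: field_simps)
    then show ?thesis unfolding cards by (simp only: power_mult_distrib mult.assoc)
  qed
  also have "\<dots> < real N ^ card I * ((1 + \<epsilon>) * real n)" using N by simp
  finally have "real (card (F <#>\<^bsub>wreath_Z_Z\<^esub> B)) < (1 + \<epsilon>) * real (card F)"
    by (simp add: cards mult_ac)
  moreover have "finite F" by (simp add: F_def I_def finite_boxed)
  moreover have "F \<subseteq> carrier wreath_Z_Z"
    by (auto simp: F_def I_def carrier_wreath_Z_Z intro: boxed_finite_support)
  ultimately show "\<exists>F. finite F \<and> F \<subseteq> carrier wreath_Z_Z \<and>
      real (card (F <#>\<^bsub>wreath_Z_Z\<^esub> B)) < (1 + \<epsilon>) * real (card F)"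
    by blast
qed

text \<open>The zero space is spanned by the empty set, hence finite-dimensional.\<close>

lemma infinite_dimensional_nonzero:
  assumes "infinite_dimensional TYPE('h::complex_hilbert_space)"
  obtains h :: "'h::complex_hilbert_space" where "h \<noteq> 0"
proof (rule ccontr)
  interpret vector_space "scaleC :: complex \<Rightarrow> 'h \<Rightarrow> 'h" by (rule vector_space_scaleC)
  assume "\<not> thesis"
  then have "(UNIV :: 'h set) = {0}" using that by blast
  then have "span {} = (UNIV :: 'h set)" by simp
  with assms show False unfolding infinite_dimensional_def by blast
qed

section \<open>Specialization of the results for groups with Folner sets to the wreath
  product\<close>

theorem mainTheorem2:
  fixes S :: "((int \<Rightarrow> int) \<times> int) set"
  assumes "finite S" and "S \<subseteq> carrier wreath_Z_Z"
    and "generate wreath_Z_Z S = carrier wreath_Z_Z"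
  shows "Metric_space.sparsification_number (carrier wreath_Z_Z) (word_dist wreath_Z_Z S) = 1 \<and>
    (infinite_dimensional TYPE('h::{complex_hilbert_space, second_countable_topology}) \<longrightarrow>
      Metric_space.operator_norm_localization (carrier wreath_Z_Z) (word_dist wreath_Z_Z S) TYPE('h))"
proof -
  interpret group wreath_Z_Z by (rule group_wreath_Z_Z)
  interpret finitely_generated_group wreath_Z_Z S by unfold_locales (use assms in auto)
  show ?thesis
    using sparsification_number_if_Folner operator_norm_localization_if_Folner
      Folner_condition_wreath_Z_Z infinite_dimensional_nonzero by metis
qed

end
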